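(* Let $h\ge 1$ and $1\le i\le h$. Let $\mathcal{D}$ be the Desarguesian $(h-1)$-spread of $\mathrm{PG}(3h-1,2)$ obtained by field reduction from $\mathrm{PG}(2,2^h)$, let $\ell_\infty$ be a line of $\mathrm{PG}(2,2^h)$ and let $H$ be the $(2h-1)$-dimensional subspace of $\mathrm{PG}(3h-1,2)$ with $\mathcal{B}(H)=\ell_\infty$. Let $\mu\subseteq H$ be an $(h-1)$-dimensional subspace such that $\mathcal{C}=\mathcal{B}(\mu)$ is an $i$-club of rank $h$ with head $N\in\ell_\infty$, and let $\rho\in\mathcal{D}$ be the spread element with $\mathcal{B}(\rho)=N$. Let $\pi$ be an $h$-dimensional subspace of $\mathrm{PG}(3h-1,2)$ with $\pi\cap H=\mu$. Then the point set $(\mathcal{B}(\pi)\setminus\mathcal{C})\cup(\ell_\infty\setminus\mathcal{C})$ is a translation KM-arc of type $2^i$ in $\mathrm{PG}(2,2^h)$ with translation line $\ell_\infty$ and with $2^i$-nucleus $N$.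
   Context: Field reduction: the vector space $\mathbb{F}_{2^h}^3$ regarded over $\mathbb{F}_2$ has dimension $3h$ and defines $\mathrm{PG}(3h-1,2)$; each point $\langle v\rangle_{\mathbb{F}_{2^h}}$ of $\mathrm{PG}(2,2^h)$ corresponds to the $(h-1)$-dimensional projective subspace of $\mathrm{PG}(3h-1,2)$ formed by the nonzero vectors of $\{\lambda v:\lambda\in\mathbb{F}_{2^h}\}$; these subspaces form the Desarguesian spread $\mathcal{D}$, and points of $\mathrm{PG}(2,2^h)$ are identified with spread elements. For $U\subseteq\mathrm{PG}(3h-1,2)$, $\mathcal{B}(U)$ is the set of points of $\mathrm{PG}(2,2^h)$ whose spread element meets $U$. For a projective subspace $\mu$ of dimension $k-1$, $\mathcal{B}(\mu)$ is an $\mathbb{F}_2$-linear set of rank $k$; the weight of a point $P=\mathcal{B}(p)$ ($p\in\mathcal{D}$) of $\mathcal{B}(\mu)$ is $\dim(\mu\cap p)+1$. An $i$-club of rank $k$ is a linear set of rank $k$ in which one point, the head, has weight $i$ and all other points have weight $1$. A KM-arc of type $t$ in $\mathrm{PG}(2,q)$ is a set of $q+t$ points such that every line meets it in $0$, $2$ or $t$ points, each of these values occurring; lines meeting it in $t$ points are $t$-secants; for $2<t<q$ the $t$-secants are concurrent and their common point is the $t$-nucleus (for a general KM-arc as here, the $2^i$-nucleus means the common point of all $2^i$-secants). A point set $S$ is a translation set with respect to a line $\ell$ (its translation line) if the group of elations with axis $\ell$ fixing $S$ acts transitively on $S\setminus\ell$; a translation KM-arc is a KM-arc that is a translation set.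
   Formalization: The claim that N is the 2^i-nucleus is stated only for i ≥ 2: for i = 1 the arc has 2^h+2 ≥ 4 points, no three collinear, so its 2-secants are never concurrent and no 2-nucleus exists; all else is stated for 1 ≤ i ≤ h. *)

theory Defs
  imports "HOL-Analysis.Analysis" "HOL-Library.Z2"
begin

text \<open>
  The field of order $2^h$ is a finite field type \<open>'a\<close>; the condition \<open>CARD('a) = 2 ^ h\<close> is a
  hypothesis of the theorem.
\<close>

subsection \<open>The plane over \<open>'a\<close>\<close>

text \<open>A point is the one-dimensional subspace it represents; a line is the set of its points.\<close>

definition plane_points :: "('a::{field,finite} ^ 3) set set" where
  "plane_points = {P. vec.subspace P \<and> vec.dim P = 1}"

definition plane_lines :: "('a::{field,finite} ^ 3) set set set" where
  "plane_lines = {{P \<in> plane_points. P \<subseteq> L} | L. vec.subspace L \<and> vec.dim L = 2}"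

subsection \<open>Field reduction\<close>

text \<open>
  Scalar multiplication by the two-element field \<^typ>\<open>bit\<close>. It is a vector space structure exactly
  when \<open>'a\<close> has characteristic 2, see \<open>vector_space_bit_scale\<close> below.
\<close>

definition bit_scale :: "bit \<Rightarrow> 'a::{field,finite} ^ 3 \<Rightarrow> 'a ^ 3" where
  "bit_scale b v = of_bool (b = 1) *s v"

text \<open>
  Points of the projective space over the two-element field are identified with the nonzero
  vectors, so that its subspaces do not contain 0. The empty subspace has dimension $-1$.
\<close>

definition proj_subspace :: "('a::{field,finite} ^ 3) set \<Rightarrow> bool" where
  "proj_subspace U \<longleftrightarrow> 0 \<notin> U \<and> module.subspace bit_scale (insert 0 U)"

definition proj_dim :: "('a::{field,finite} ^ 3) set \<Rightarrow> int" where
  "proj_dim U = int (vector_space.dim bit_scale U) - 1"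

definition spread_element :: "('a::{field,finite} ^ 3) set \<Rightarrow> ('a ^ 3) set" where
  "spread_element P = P - {0}"

definition desarguesian_spread :: "('a::{field,finite} ^ 3) set set" where
  "desarguesian_spread = spread_element ` plane_points"

definition B_set :: "('a::{field,finite} ^ 3) set \<Rightarrow> ('a ^ 3) set set" where
  "B_set U = {P \<in> plane_points. spread_element P \<inter> U \<noteq> {}}"

definition weight :: "('a::{field,finite} ^ 3) set \<Rightarrow> ('a ^ 3) set \<Rightarrow> int" where
  "weight \<mu> P = proj_dim (\<mu> \<inter> spread_element P) + 1"

text \<open>
  Weights depend on the subspace \<open>\<mu>\<close> and not only on its linear set, so being a club is a property
  of \<open>\<mu>\<close>. For \<open>i = 1\<close> any point of the linear set can serve as the head \<open>N\<close>.
\<close>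

definition club :: "nat \<Rightarrow> nat \<Rightarrow> ('a::{field,finite} ^ 3) set \<Rightarrow> ('a ^ 3) set \<Rightarrow> bool" where
  "club i k \<mu> N \<longleftrightarrow>
     proj_subspace \<mu> \<and> proj_dim \<mu> = int k - 1 \<and>
     N \<in> B_set \<mu> \<and> weight \<mu> N = int i \<and> (\<forall>P \<in> B_set \<mu> - {N}. weight \<mu> P = 1)"

subsection \<open>KM-arcs\<close>

definition KM_arc :: "nat \<Rightarrow> ('a::{field,finite} ^ 3) set set \<Rightarrow> bool" where
  "KM_arc t S \<longleftrightarrow>
     S \<subseteq> plane_points \<and> card S = CARD('a) + t \<and>
     (\<forall>m \<in> plane_lines. card (S \<inter> m) \<in> {0, 2, t}) \<and>
     (\<forall>n \<in> {0, 2, t}. \<exists>m \<in> plane_lines. card (S \<inter> m) = n)"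

definition secants :: "nat \<Rightarrow> ('a::{field,finite} ^ 3) set set \<Rightarrow> ('a ^ 3) set set set" where
  "secants t S = {m \<in> plane_lines. card (S \<inter> m) = t}"

definition nucleus :: "nat \<Rightarrow> ('a::{field,finite} ^ 3) set set \<Rightarrow> ('a ^ 3) set \<Rightarrow> bool" where
  "nucleus t S N \<longleftrightarrow> {P \<in> plane_points. \<forall>m \<in> secants t S. P \<in> m} = {N}"

subsection \<open>Elations and translation sets\<close>

definition collineation :: "(('a::{field,finite} ^ 3) set \<Rightarrow> ('a ^ 3) set) \<Rightarrow> bool" where
  "collineation \<phi> \<longleftrightarrow>
     bij_betw \<phi> plane_points plane_points \<and> bij_betw ((`) \<phi>) plane_lines plane_lines"

text \<open>The identity counts as an elation, so that the elations with a given axis form a group.\<close>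

definition elation ::
  "('a::{field,finite} ^ 3) set set \<Rightarrow> (('a ^ 3) set \<Rightarrow> ('a ^ 3) set) \<Rightarrow> bool" where
  "elation l \<phi> \<longleftrightarrow>
     collineation \<phi> \<and> (\<forall>P \<in> l. \<phi> P = P) \<and>
     (\<exists>Z \<in> l. \<forall>m \<in> plane_lines. Z \<in> m \<longrightarrow> \<phi> ` m = m)"

definition translation_set ::
  "('a::{field,finite} ^ 3) set set \<Rightarrow> ('a ^ 3) set set \<Rightarrow> bool" where
  "translation_set l S \<longleftrightarrow>
     S \<subseteq> plane_points \<and> l \<in> plane_lines \<and>
     (\<forall>P \<in> S - l. \<forall>Q \<in> S - l. \<exists>\<phi>. elation l \<phi> \<and> \<phi> ` S = S \<and> \<phi> P = Q)"

definition translation_KM_arc ::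
  "nat \<Rightarrow> ('a::{field,finite} ^ 3) set set \<Rightarrow> ('a ^ 3) set set \<Rightarrow> bool" where
  "translation_KM_arc t l S \<longleftrightarrow> KM_arc t S \<and> translation_set l S"

subsection \<open>The vector space structure over the two-element field\<close>

lemma vector_space_bit_scale:
  assumes "CARD('a::{field,finite}) = 2 ^ h"
  shows "vector_space (bit_scale :: bit \<Rightarrow> 'a ^ 3 \<Rightarrow> 'a ^ 3)"
proof -
  have "(\<Sum>x\<in>(UNIV::'a set). x + 1) = (\<Sum>x\<in>(UNIV::'a set). x)"
    by (rule sum.reindex_bij_witness[of _ "\<lambda>x. x - 1" "\<lambda>x. x + 1"]) auto
  then have "(of_nat CARD('a) :: 'a) = 0"
    by (simp add: sum.distrib)
  with assms have "(2::'a) ^ h = 0"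
    by simp
  then have "(2::'a) = 0"
    by simp
  then have "(1::'a) + 1 = 0"
    by (simp only: one_add_one)
  then have double: "v + v = 0" for v :: "'a ^ 3"
    by (metis vec.scale_left_distrib vec.scale_one vec.scale_zero_left)
  show ?thesis
  proof
    show "bit_scale a (x + y) = bit_scale a x + bit_scale a y" for a and x y :: "'a ^ 3"
      by (simp add: bit_scale_def vec.scale_right_distrib)
    show "bit_scale (a + b) x = bit_scale a x + bit_scale b x" for a b and x :: "'a ^ 3"
      by (cases a; cases b) (simp_all add: bit_scale_def double)
    show "bit_scale a (bit_scale b x) = bit_scale (a * b) x" for a b and x :: "'a ^ 3"
      by (cases a; cases b) (simp_all add: bit_scale_def)
    show "bit_scale 1 x = x" for x :: "'a ^ 3"
      by (simp add: bit_scale_def)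
  qed
qed

end

(*
  Write M for mu with 0 added and L for the plane of vectors spanned by the axis. Then pi consists
  of M - {0} and a coset v + M with v outside L, so the affine points of the arc are the points
  <v + u> with u in M. Let K be the plane of vectors of a line other than the axis, meeting the
  axis in P. The vectors u in M with v + u in K are either absent or form a coset of the
  intersection of M and P. If P is not a direction, then M and P meet trivially and, by counting,
  M + P = L, so there is exactly one affine point on the line; together with P this gives 2.
  If P is a direction, the line contains no affine points or as many as M meets P in, which is 2
  for P distinct from N and t = 2^i for P = N. The maps x -> x + f(x) w, where f is the linear form
  with kernel L and f(v) = 1 and where w is in M, are the required elations.
*)

theory Submission
  imports Defs
begin

section \<open>Sizes of subspaces over a finite field\<close>

text \<open>Each new basis vector \<open>b\<close> multiplies the size by the order of the field,
  since the elements of the larger span are uniquely \<open>scale k b + x\<close> with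
  \<open>x\<close> in the smaller one.\<close>

lemma (in vector_space) card_span_independent:
  assumes "finite (UNIV :: 'a set)" "finite B" "independent B"
  shows "card (span B) = CARD('a) ^ card B"
  using assms(2,3)
proof (induction B rule: finite_induct)
  case empty
  then show ?case by simp
next
  case (insert b B)
  then have b: "b \<notin> span B" and B: "independent B"
    by (auto simp: independent_insert)
  let ?f = "\<lambda>(k, x). scale k b + x"
  have "inj_on ?f (UNIV \<times> span B)"
  proof (rule inj_onI, clarify)
    fix k x k' x'
    assume x: "x \<in> span B" "x' \<in> span B" and eq: "scale k b + x = scale k' b + x'"
    have "scale (k - k') b = x' - x"
      using eq by (simp add: scale_left_diff_distrib algebra_simps)
    then have "scale (k - k') b \<in> span B"
      using x by (simp add: span_diff)
    then have "scale (inverse (k - k')) (scale (k - k') b) \<in> span B"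
      by (rule span_scale)
    then have "k = k'"
      using b by (cases "k = k'") auto
    with eq show "k = k' \<and> x = x'" by simp
  qed
  moreover have "?f ` (UNIV \<times> span B) = span (insert b B)"
  proof (safe)
    fix k x assume "x \<in> span B"
    then show "scale k b + x \<in> span (insert b B)"
      by (auto simp: span_breakdown_eq intro!: exI[of _ k])
  next
    fix x assume "x \<in> span (insert b B)"
    then obtain k where "x - scale k b \<in> span B"
      by (auto simp: span_breakdown_eq)
    then show "x \<in> ?f ` (UNIV \<times> span B)"
      by (intro image_eqI[of _ _ "(k, x - scale k b)"]) auto
  qed
  ultimately have "card (span (insert b B)) = card ((UNIV :: 'a set) \<times> span B)"
    by (metis card_image)
  also have "\<dots> = CARD('a) ^ card (insert b B)"
    using insert B by (simp add: card_cartesian_product)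
  finally show ?case .
qed

text \<open>Kept general in the scalar field because it is applied over two of them: over
  \<open>'a\<close> to points and planes of vectors, and over \<open>bit\<close> to the subspaces
  that come from field reduction.\<close>

lemma (in vector_space) card_subspace:
  assumes "finite (UNIV :: 'a set)" "subspace V" "finite V"
  shows "card V = CARD('a) ^ dim V"
proof -
  obtain B where "B \<subseteq> V" "independent B" "V \<subseteq> span B" "card B = dim V"
    by (rule basis_exists)
  moreover have "span B = V"
    using calculation assms span_minimal by blast
  ultimately show ?thesis
    using card_span_independent[of B] assms finite_subset by metis
qed

section \<open>Points of the plane as one-dimensional subspaces\<close>

lemma span_singleton_subset_iff:
  "vec.subspace K \<Longrightarrow> vec.span {x} \<subseteq> K \<longleftrightarrow> x \<in> K"
  using vec.span_minimal[of "{x}" K] vec.span_base[of x "{x}"] by auto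

lemma span_in_plane_points: "x \<noteq> 0 \<Longrightarrow> vec.span {x} \<in> plane_points"
  by (simp add: plane_points_def vec.subspace_span vec.dim_span)

lemma plane_point_eq_span:
  assumes "P \<in> plane_points" "x \<in> P" "x \<noteq> 0"
  shows "P = vec.span {x}"
proof -
  have P: "vec.subspace P" "vec.dim P = 1"
    using assms by (auto simp: plane_points_def)
  show ?thesis
    using vec.subspace_dim_equal[of "vec.span {x}" P] P assms
    by (simp add: vec.span_minimal vec.dim_span)
qed

lemma plane_points_eqI:
  "P \<in> plane_points \<Longrightarrow> Q \<in> plane_points \<Longrightarrow> x \<in> P \<Longrightarrow> x \<in> Q \<Longrightarrow> x \<noteq> 0 \<Longrightarrow> P = Q"
  using plane_point_eq_span by metis

lemma plane_point_nonzero: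
  assumes "P \<in> plane_points"
  shows "\<exists>x\<in>P. x \<noteq> 0"
proof -
  have "\<not> P \<subseteq> {0}"
    using assms vec.dim_subset[of P "{0}"] by (auto simp: plane_points_def)
  then show ?thesis by blast
qed

lemma card_plane_point:
  fixes P :: "('a::{field,finite} ^ 3) set"
  shows "P \<in> plane_points \<Longrightarrow> card P = CARD('a)"
  using vec.card_subspace[of P] by (simp add: plane_points_def)

text \<open>Every nonzero vector lies in exactly one point, namely its span, so the points partition
  the nonzero vectors. This turns counts of vectors into counts of points.\<close>

lemma sum_card_plane_points:
  fixes X :: "('a::{field,finite} ^ 3) set"
  assumes "0 \<notin> X"
  shows "card X = (\<Sum>P\<in>B_set X. card (X \<inter> P))"
proof -
  have "X = (\<Union>P\<in>B_set X. X \<inter> P)"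
  proof (intro equalityI subsetI)
    fix x assume x: "x \<in> X"
    then have "vec.span {x} \<in> B_set X"
      using assms span_in_plane_points[of x]
      by (auto simp: B_set_def spread_element_def intro: vec.span_base)
    then show "x \<in> (\<Union>P\<in>B_set X. X \<inter> P)"
      using x by (auto intro: vec.span_base)
  qed auto
  moreover have "card (\<Union>P\<in>B_set X. X \<inter> P) = (\<Sum>P\<in>B_set X. card (X \<inter> P))"
  proof (rule card_UN_disjoint)
    show "\<forall>P\<in>B_set X. \<forall>Q\<in>B_set X. P \<noteq> Q \<longrightarrow> (X \<inter> P) \<inter> (X \<inter> Q) = {}"
      using assms plane_points_eqI by (fastforce simp: B_set_def)
  qed auto
  ultimately show ?thesis by simp
qed

section \<open>The arc built from an additive group of vectors on the axis\<close>

text \<open>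
  Only the sizes of the intersections of \<open>M\<close> with the points matter, so the linear set is given by
  an additive subgroup \<open>M\<close> of a field of any characteristic; \<open>M\<close> contains 0, unlike \<open>\<mu>\<close>.
\<close>

locale affine_club =
  fixes L M N :: "('a::{field,finite} ^ 3) set" and v :: "'a ^ 3" and t :: nat
  assumes subspace_L: "vec.subspace L" and dim_L: "vec.dim L = 2"
    and v_notin: "v \<notin> L"
    and M_subset: "M \<subseteq> L" and zero_M: "0 \<in> M"
    and diff_M: "\<And>x y. x \<in> M \<Longrightarrow> y \<in> M \<Longrightarrow> x - y \<in> M"
    and card_M: "card M = CARD('a)"
    and N_point: "N \<in> plane_points" and N_subset: "N \<subseteq> L"
    and card_M_N: "card (M \<inter> N) = t" and t_ge: "2 \<le> t"
    and card_M_other: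
      "\<And>P. P \<in> plane_points \<Longrightarrow> P \<noteq> N \<Longrightarrow> M \<inter> P \<noteq> {0} \<Longrightarrow> card (M \<inter> P) = 2"
begin

definition axis :: "('a ^ 3) set set"
  where "axis = {P \<in> plane_points. P \<subseteq> L}"

text \<open>For distinct \<open>u\<close>, \<open>u'\<close> in \<open>M\<close> the line joining
  the spans of \<open>v + u\<close> and \<open>v + u'\<close> meets the axis in the span of
  \<open>u - u'\<close>. These are thus the directions determined by the affine points.\<close>

definition directions :: "('a ^ 3) set set"
  where "directions = B_set (M - {0})"

text \<open>A point off the axis has exactly one spanning vector of the form \<open>v + w\<close>
  with \<open>w\<close> in \<open>L\<close>; here \<open>w\<close> is restricted to
  \<open>M\<close>.\<close>

definition affine_points :: "('a ^ 3) set set"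
  where "affine_points = (\<lambda>u. vec.span {v + u}) ` M"

definition arc :: "('a ^ 3) set set"
  where "arc = affine_points \<union> (axis - directions)"

section \<open>Counting the points of the axis and the directions\<close>

lemma plus_M: "x \<in> M \<Longrightarrow> y \<in> M \<Longrightarrow> x + y \<in> M"
  using diff_M[of x "0 - y"] diff_M[of 0 y] zero_M by simp

lemma axis_line: "axis \<in> plane_lines"
  using subspace_L dim_L by (auto simp: axis_def plane_lines_def)

lemma card_L: "card L = CARD('a) * CARD('a)"
  using vec.card_subspace[of L] subspace_L dim_L by (simp add: power2_eq_square)

lemma in_directions_iff:
  "P \<in> plane_points \<Longrightarrow> P \<in> directions \<longleftrightarrow> M \<inter> P \<noteq> {0}"
  using zero_M vec.subspace_0[of P]
  by (auto simp: directions_def B_set_def spread_element_def plane_points_def)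

lemma directions_subset_axis: "directions \<subseteq> axis"
proof
  fix P assume P: "P \<in> directions"
  then obtain x where "x \<in> M" "x \<in> P" "x \<noteq> 0" "P \<in> plane_points"
    by (auto simp: directions_def B_set_def spread_element_def)
  then show "P \<in> axis"
    using plane_point_eq_span[of P x] M_subset vec.span_minimal[of "{x}" L] subspace_L
    by (auto simp: axis_def)
qed

lemma N_axis: "N \<in> axis"
  using N_point N_subset by (simp add: axis_def)

lemma N_directions: "N \<in> directions"
proof -
  have "M \<inter> N \<noteq> {0}"
  proof
    assume "M \<inter> N = {0}"
    then have "t = 1" using card_M_N by simp
    with t_ge show False by simp
  qed
  then show ?thesis
    using in_directions_iff[OF N_point] by simp
qed

text \<open>With q the order of the field, \<open>L\<close> has q^2 - 1 nonzero vectors and each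
  point of the axis accounts for q - 1 of them.\<close>

lemma card_axis: "card axis = CARD('a) + 1"
proof -
  have q: "CARD('a) \<ge> 2"
    using card_mono[of UNIV "{0, 1 :: 'a}"] by simp
  have B: "B_set (L - {0}) = axis"
  proof (intro equalityI subsetI)
    fix P assume "P \<in> B_set (L - {0})"
    then obtain x where "x \<in> L" "x \<in> P" "x \<noteq> 0" "P \<in> plane_points"
      by (auto simp: B_set_def spread_element_def)
    then show "P \<in> axis"
      using plane_point_eq_span[of P x] vec.span_minimal[of "{x}" L] subspace_L
      by (auto simp: axis_def)
  next
    fix P assume "P \<in> axis"
    then show "P \<in> B_set (L - {0})"
      using plane_point_nonzero[of P]
      by (auto simp: B_set_def spread_element_def axis_def)
  qed
  have "card (L - {0}) = (\<Sum>P\<in>axis. card ((L - {0}) \<inter> P))"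
    using sum_card_plane_points[of "L - {0}"] by (simp add: B)
  also have "\<dots> = (\<Sum>P\<in>axis. CARD('a) - 1)"
  proof (rule sum.cong)
    fix P assume "P \<in> axis"
    then have "P \<in> plane_points" "(L - {0}) \<inter> P = P - {0}" "0 \<in> P"
      by (auto simp: axis_def plane_points_def vec.subspace_0)
    then show "card ((L - {0}) \<inter> P) = CARD('a) - 1"
      by (simp add: card_plane_point)
  qed simp
  finally have "card axis * (CARD('a) - 1) = CARD('a) * CARD('a) - 1"
    using vec.subspace_0[OF subspace_L] by (simp add: card_L)
  also have "\<dots> = (CARD('a) + 1) * (CARD('a) - 1)"
    using q by (simp add: algebra_simps diff_mult_distrib2)
  finally show ?thesis
    using q by (simp only: mult_cancel2) auto
qed

text \<open>Of the q - 1 nonzero vectors of \<open>M\<close>, \<open>t - 1\<close> lie in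
  \<open>N\<close> and each other direction contains exactly one.\<close>

lemma card_directions: "card directions + t = CARD('a) + 1"
proof -
  have card_Int: "card ((M - {0}) \<inter> P) = card (M \<inter> P) - 1" if "P \<in> plane_points" for P
  proof -
    have "(M - {0}) \<inter> P = (M \<inter> P) - {0}" "0 \<in> M \<inter> P"
      using that zero_M by (auto simp: plane_points_def vec.subspace_0)
    then show ?thesis by simp
  qed
  have "card (M - {0}) = (\<Sum>P\<in>directions. card ((M - {0}) \<inter> P))"
    using sum_card_plane_points[of "M - {0}"] by (simp add: directions_def)
  also have "\<dots> = card ((M - {0}) \<inter> N) + (\<Sum>P\<in>directions - {N}. card ((M - {0}) \<inter> P))"
    using N_directions by (simp add: sum.remove)
  also have "(\<Sum>P\<in>directions - {N}. card ((M - {0}) \<inter> P)) = (\<Sum>P\<in>directions - {N}. 1)"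
  proof (rule sum.cong)
    fix P assume P: "P \<in> directions - {N}"
    then have "P \<in> plane_points"
      using directions_subset_axis by (auto simp: axis_def)
    then show "card ((M - {0}) \<inter> P) = 1"
      using P card_M_other[of P] by (simp add: card_Int in_directions_iff)
  qed simp
  also have "card ((M - {0}) \<inter> N) = t - 1"
    using card_Int N_point card_M_N by simp
  finally have "CARD('a) - 1 = (t - 1) + (card directions - 1)"
    using zero_M N_directions by (simp add: card_M)
  \<comment> \<open>Together with \<open>2 \<le> t\<close> and q > 0 this ensures that no
    subtraction of natural numbers in the equation is truncated.\<close>
  moreover have "card directions > 0"
    using N_directions by (auto simp: card_gt_0_iff)
  ultimately show ?thesis
    using t_ge zero_less_card_finite[where 'a='a] by linarith
qed

lemma card_axis_minus_directions: "card (axis - directions) = t"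
  using card_Diff_subset[OF _ directions_subset_axis] card_axis card_directions by simp

section \<open>Coordinates with respect to \<open>v\<close> and \<open>L\<close>, and the size of
  the arc\<close>

text \<open>\<open>L\<close> has codimension 1 and misses \<open>v\<close>, so adjoining
  \<open>v\<close> to it spans the whole space.\<close>

lemma decompose:
  obtains k w where "w \<in> L" "x = k *s v + w"
proof -
  have span_L: "vec.span L = L"
    using subspace_L by simp
  have "vec.dim (insert v L) = 3"
    using v_notin dim_L by (simp add: vec.dim_insert span_L)
  then have "vec.span (insert v L) = UNIV"
    by (simp add: vec.dim_eq_full[symmetric] vec.dimension_def card_cart_basis)
  then obtain k where "x - k *s v \<in> L"
    using vec.span_breakdown_eq[of x v L] unfolding span_L by auto
  then show ?thesis
    using that[of "x - k *s v" k] by simp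
qed

lemma decompose_unique:
  assumes "w \<in> L" "w' \<in> L" "k *s v + w = k' *s v + w'"
  shows "k = k' \<and> w = w'"
proof -
  have "(k - k') *s v = w' - w"
    using assms(3) by (simp add: algebra_simps)
  also have "\<dots> \<in> L"
    using assms subspace_L by (intro vec.subspace_diff)
  finally have mem: "(k - k') *s v \<in> L" .
  have "k = k'"
  proof (rule ccontr)
    assume "k \<noteq> k'"
    then have "v = inverse (k - k') *s ((k - k') *s v)"
      by (metis left_inverse right_minus_eq vec.scale_one vec.scale_scale)
    then have "v \<in> L"
      using mem vec.subspace_scale[OF subspace_L] by metis
    with v_notin show False by simp
  qed
  with assms(3) show ?thesis by simp
qed

lemma affine_notin: "w \<in> L \<Longrightarrow> v + w \<notin> L"
  using v_notin vec.subspace_diff[OF subspace_L, of "v + w" w] by auto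

lemma affine_nonzero: "w \<in> L \<Longrightarrow> v + w \<noteq> 0"
  using affine_notin vec.subspace_0[OF subspace_L] by metis

text \<open>Vectors spanning the same point are proportional; as both have
  \<open>v\<close>-coefficient 1, the factor is 1.\<close>

lemma inj_affine: "inj_on (\<lambda>u. vec.span {v + u}) M"
proof (rule inj_onI)
  fix x y assume xy: "x \<in> M" "y \<in> M" "vec.span {v + x} = vec.span {v + y}"
  then have "v + x \<in> vec.span {v + y}"
    using vec.span_base[of "v + x" "{v + x}"] by auto
  then obtain c where "v + x = c *s (v + y)"
    by (auto simp: vec.span_singleton)
  then have "1 *s v + x = c *s v + c *s y"
    by (simp add: vec.scale_right_distrib)
  then have "1 = c \<and> x = c *s y"
    using xy M_subset vec.subspace_scale[OF subspace_L] by (intro decompose_unique) auto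
  then show "x = y" by auto
qed

lemma card_affine_points: "card affine_points = CARD('a)"
  by (simp add: affine_points_def card_image[OF inj_affine] card_M)

lemma affine_points_axis: "affine_points \<inter> axis = {}"
  using affine_notin M_subset span_singleton_subset_iff[OF subspace_L]
  by (auto simp: affine_points_def axis_def)

lemma affine_points_subset: "affine_points \<subseteq> plane_points"
  using affine_nonzero M_subset span_in_plane_points by (auto simp: affine_points_def)

lemma arc_subset: "arc \<subseteq> plane_points"
  using affine_points_subset by (auto simp: arc_def axis_def)

lemma card_arc: "card arc = CARD('a) + t"
  unfolding arc_def using affine_points_axis
  by (subst card_Un_disjoint)
     (auto simp: card_affine_points card_axis_minus_directions)

lemma arc_Int_axis: "arc \<inter> axis = axis - directions"
  using affine_points_axis by (auto simp: arc_def)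

section \<open>Intersections of the arc with lines other than the axis\<close>

text \<open>A vector of \<open>K\<close> outside \<open>L\<close> has nonzero
  \<open>v\<close>-coefficient and can be rescaled to make it 1. It also shows that \<open>K\<close>
  and \<open>L\<close> together span everything, so the dimension formula leaves 2 + 2 - 3 = 1 for
  the intersection.\<close>

lemma plane_points_Int_L:
  assumes K: "vec.subspace K" "vec.dim K = 2" "K \<noteq> L"
  shows "K \<inter> L \<in> plane_points"
    and "\<exists>w\<in>L. v + w \<in> K"
proof -
  have "\<not> K \<subseteq> L"
    using vec.subspace_dim_equal[of K L] K subspace_L dim_L by auto
  then obtain x where x: "x \<in> K" "x \<notin> L" by blast
  obtain k w where w: "w \<in> L" "x = k *s v + w" by (rule decompose)
  with x have "k \<noteq> 0" by auto
  then have "inverse k *s x = v + inverse k *s w"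
    using w by (simp add: vec.scale_right_distrib)
  then have "v + inverse k *s w \<in> K" "inverse k *s w \<in> L"
    using x w K subspace_L by (metis vec.subspace_scale)+
  then show "\<exists>w\<in>L. v + w \<in> K" by blast
  have "{a + b |a b. a \<in> K \<and> b \<in> L} = UNIV"
  proof (intro equalityI subsetI UNIV_I)
    fix y :: "'a ^ 3"
    obtain k' w' where w': "w' \<in> L" "y = k' *s v + w'" by (rule decompose)
    \<comment> \<open>The multiple of \<open>x\<close> is chosen to have the same
      \<open>v\<close>-coefficient \<open>k'\<close> as \<open>y\<close>, so the remainder lies in
      \<open>L\<close>.\<close>
    have "y = (k' * inverse k) *s x + (w' - (k' * inverse k) *s w)"
      using w(2) w'(2) \<open>k \<noteq> 0\<close> by (simp add: vec.scale_right_distrib)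
    moreover have "(k' * inverse k) *s x \<in> K" "w' - (k' * inverse k) *s w \<in> L"
      using x(1) w(1) w'(1) K(1) subspace_L
      by (simp_all only: vec.subspace_scale vec.subspace_diff)
    ultimately show "y \<in> {a + b |a b. a \<in> K \<and> b \<in> L}" by blast
  qed
  then have "3 + vec.dim (K \<inter> L) = 2 + 2"
    using vec.dim_sums_Int[of K L] K subspace_L dim_L
    by (simp add: card_cart_basis)
  then show "K \<inter> L \<in> plane_points"
    using K subspace_L by (simp add: plane_points_def vec.subspace_inter)
qed

text \<open>Supplies explicit lines with a prescribed point on the axis, for exhibiting secants of
  each kind.\<close>

lemma line_through_affine:
  assumes P: "P \<in> axis" and w: "w \<in> L"
  defines "K \<equiv> vec.span (insert (v + w) P)"
  shows "vec.subspace K" "vec.dim K = 2" "K \<noteq> L" "K \<inter> L = P" "v + w \<in> K"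
proof -
  have P': "vec.subspace P" "vec.dim P = 1" "P \<subseteq> L" "P \<in> plane_points"
    using P by (auto simp: axis_def plane_points_def)
  then have span_P: "vec.span P = P" by simp
  show K: "vec.subspace K" by (simp add: K_def)
  have "v + w \<notin> P"
    using P' affine_notin w by blast
  then show dim: "vec.dim K = 2"
    using P' by (simp add: K_def vec.dim_insert span_P)
  show vw: "v + w \<in> K" by (simp add: K_def vec.span_base)
  then show neq: "K \<noteq> L"
    using affine_notin w by blast
  have "P \<subseteq> K" by (auto simp: K_def vec.span_base)
  then have "P \<subseteq> K \<inter> L" using P' by auto
  obtain x where x: "x \<in> P" "x \<noteq> 0"
    using plane_point_nonzero[OF P'(4)] by blast
  then show "K \<inter> L = P"
    using plane_points_eqI[of "K \<inter> L" P x] plane_points_Int_L(1)[OF K dim neq] P'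
      \<open>P \<subseteq> K \<inter> L\<close> by auto
qed

text \<open>\<open>M \<times> P\<close> and \<open>L\<close> both have q^2 elements, so addition
  maps onto \<open>L\<close> exactly when it is injective, that is, when \<open>M\<close> and
  \<open>P\<close> meet only in 0. One direction yields affine points on lines through
  non-directions, the other yields lines through \<open>N\<close> without affine points.\<close>

lemma sum_eq_L_iff:
  assumes P: "P \<in> axis"
  shows "(\<lambda>(m, p). m + p) ` (M \<times> P) = L \<longleftrightarrow> P \<notin> directions"
proof -
  let ?f = "\<lambda>(m, p). m + p"
  have P': "vec.subspace P" "P \<subseteq> L" "P \<in> plane_points"
    using P by (auto simp: axis_def plane_points_def)
  have sub: "?f ` (M \<times> P) \<subseteq> L"
    using P' M_subset vec.subspace_add[OF subspace_L] by auto
  have card: "card (M \<times> P) = card L"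
    using P' by (simp add: card_cartesian_product card_M card_plane_point card_L)
  have "?f ` (M \<times> P) = L \<longleftrightarrow> inj_on ?f (M \<times> P)"
    using sub card by (metis card_image card_subset_eq eq_card_imp_inj_on finite)
  also have "\<dots> \<longleftrightarrow> M \<inter> P = {0}"
  proof
    assume inj: "inj_on ?f (M \<times> P)"
    show "M \<inter> P = {0}"
    proof (intro equalityI subsetI)
      fix x assume "x \<in> M \<inter> P"
      then show "x \<in> {0}"
        using inj_onD[OF inj, of "(x, 0)" "(0, x)"] zero_M vec.subspace_0[OF P'(1)] by auto
    qed (use zero_M vec.subspace_0[OF P'(1)] in auto)
  next
    assume 0: "M \<inter> P = {0}"
    show "inj_on ?f (M \<times> P)"
    proof (rule inj_onI, clarify)
      fix m p m' p'
      assume mp: "m \<in> M" "p \<in> P" "m' \<in> M" "p' \<in> P" "m + p = m' + p'"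
      then have eq: "m - m' = p' - p" by (simp add: algebra_simps)
      have "m - m' \<in> M" "p' - p \<in> P"
        using mp diff_M vec.subspace_diff[OF P'(1)] by auto
      then have "m - m' \<in> M \<inter> P"
        using eq by (metis IntI)
      then have "m - m' = 0"
        by (simp only: 0 singleton_iff)
      then show "m = m' \<and> p = p'" using eq by simp
    qed
  qed
  finally show ?thesis
    using P' by (simp add: in_directions_iff)
qed

text \<open>\<open>E\<close> parametrises the affine points on the line. The only other candidate is
  the point \<open>K \<inter> L\<close> of the axis, which lies on the arc exactly when it is not a
  direction.\<close>

lemma card_arc_Int:
  assumes K: "vec.subspace K" "vec.dim K = 2" "K \<noteq> L"
  defines "E \<equiv> {u \<in> M. v + u \<in> K}"
  shows "card (arc \<inter> {P \<in> plane_points. P \<subseteq> K}) =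
    (if K \<inter> L \<notin> directions then 2 else if E = {} then 0 else card (M \<inter> (K \<inter> L)))"
proof -
  define P where "P = K \<inter> L"
  have P: "P \<in> plane_points" "P \<in> axis"
    using plane_points_Int_L(1)[OF K] by (auto simp: P_def axis_def)
  let ?m = "{P \<in> plane_points. P \<subseteq> K}"
  have m: "affine_points \<inter> ?m = (\<lambda>u. vec.span {v + u}) ` E"
    using affine_points_subset span_singleton_subset_iff[OF K(1)]
    by (auto simp: affine_points_def E_def)
  have card_E: "card (affine_points \<inter> ?m) = card E"
    unfolding m by (rule card_image, rule inj_on_subset[OF inj_affine]) (auto simp: E_def)
  have "axis \<inter> ?m = {P}"
  proof (intro equalityI subsetI)
    fix Q assume Q: "Q \<in> axis \<inter> ?m"
    then have "Q \<in> plane_points" "Q \<subseteq> P"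
      by (auto simp: P_def axis_def)
    then have "Q = P"
      using plane_point_nonzero[of Q] plane_points_eqI[OF _ P(1)] by blast
    then show "Q \<in> {P}" by simp
  qed (use P in \<open>auto simp: P_def\<close>)
  then have "arc \<inter> ?m = (affine_points \<inter> ?m) \<union> ({P} - directions)"
    by (auto simp: arc_def)
  moreover have "card ((affine_points \<inter> ?m) \<union> ({P} - directions))
      = card E + card ({P} - directions)"
    using affine_points_axis P card_E by (subst card_Un_disjoint) auto
  ultimately have card_arc_m: "card (arc \<inter> ?m) = card E + card ({P} - directions)"
    by simp
  \<comment> \<open>Two elements of \<open>E\<close> differ by an element of \<open>M\<close> that
    lies in \<open>K\<close>, hence in \<open>P\<close> because
    \<open>M \<subseteq> L\<close>.\<close>
  have E_coset: "card E = card (M \<inter> P)" if "u0 \<in> E" for u0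
  proof -
    have u0: "u0 \<in> M" "v + u0 \<in> K" using that by (auto simp: E_def)
    have "E = (\<lambda>x. u0 + x) ` (M \<inter> P)"
    proof (intro equalityI subsetI)
      fix u assume u: "u \<in> E"
      then have "(v + u) - (v + u0) \<in> K"
        using u0 by (intro vec.subspace_diff[OF K(1)]) (auto simp: E_def)
      moreover have "u - u0 \<in> M"
        using u u0 diff_M by (simp add: E_def)
      ultimately have "u - u0 \<in> M \<inter> P"
        using M_subset by (auto simp: P_def)
      then show "u \<in> (\<lambda>x. u0 + x) ` (M \<inter> P)"
        by (intro image_eqI[of _ _ "u - u0"]) auto
    next
      fix u assume "u \<in> (\<lambda>x. u0 + x) ` (M \<inter> P)"
      then obtain x where x: "x \<in> M" "x \<in> K" "u = u0 + x" by (auto simp: P_def)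
      then show "u \<in> E"
        using u0 plus_M vec.subspace_add[OF K(1), of "v + u0" x]
        by (auto simp: E_def add.assoc)
    qed
    then show ?thesis by (simp add: card_image)
  qed
  show ?thesis
  proof (cases "P \<in> directions")
    case True
    then show ?thesis
      using card_arc_m E_coset by (auto simp: P_def)
  next
    case False
    obtain w where w: "w \<in> L" "v + w \<in> K"
      using plane_points_Int_L(2)[OF K] by blast
    \<comment> \<open>Splitting \<open>w\<close> as \<open>u + p\<close> replaces it by an element
      of \<open>M\<close>: subtracting \<open>p\<close> does not leave \<open>K\<close>.\<close>
    have "w \<in> (\<lambda>(m, p). m + p) ` (M \<times> P)"
      using sum_eq_L_iff[OF P(2)] False w(1) by blast
    then obtain u p where up: "u \<in> M" "p \<in> P" "w = u + p"
      by auto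
    have "(v + w) - p \<in> K"
      using w up(2) by (intro vec.subspace_diff[OF K(1)]) (auto simp: P_def)
    then have "u \<in> E"
      using up by (simp add: E_def)
    then have "card E = 1"
      using E_coset False P by (simp add: in_directions_iff)
    then show ?thesis
      using card_arc_m False by (simp add: P_def insert_Diff_if)
  qed
qed

section \<open>The secants of the arc and their common point\<close>

lemma line_cases:
  assumes "m \<in> plane_lines" "m \<noteq> axis"
  obtains K where "m = {P \<in> plane_points. P \<subseteq> K}" "vec.subspace K" "vec.dim K = 2" "K \<noteq> L"
  using assms by (auto simp: plane_lines_def axis_def)

text \<open>The axis is a \<open>t\<close>-secant, its points on the arc being the \<open>t\<close>
  non-directions; the intersection formula settles all other lines. What remains is to exhibit a
  line for each value.\<close>

lemma KM_arc_arc: "KM_arc t arc"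
proof -
  have "card (arc \<inter> m) \<in> {0, 2, t}" if "m \<in> plane_lines" for m
  proof (cases "m = axis")
    case True
    then show ?thesis by (simp add: arc_Int_axis card_axis_minus_directions)
  next
    case False
    with that obtain K where K: "m = {P \<in> plane_points. P \<subseteq> K}"
      "vec.subspace K" "vec.dim K = 2" "K \<noteq> L" by (rule line_cases)
    have P: "K \<inter> L \<in> plane_points"
      using K plane_points_Int_L by blast
    then have "K \<inter> L \<in> directions \<Longrightarrow> card (M \<inter> (K \<inter> L)) \<in> {2, t}"
      using card_M_other[OF P] card_M_N by (auto simp: in_directions_iff)
    then show ?thesis
      using card_arc_Int[OF K(2-4)] K(1) by auto
  qed
  moreover have "\<exists>m \<in> plane_lines. card (arc \<inter> m) = 0"
  proof -
    \<comment> \<open>Since \<open>N\<close> is a direction, \<open>M + N\<close> is a proper subset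
      of \<open>L\<close>. For \<open>w\<close> outside it, the line through \<open>N\<close> and
      the span of \<open>v + w\<close> misses the arc.\<close>
    obtain w where w: "w \<in> L" "w \<notin> (\<lambda>(m, p). m + p) ` (M \<times> N)"
    proof -
      have "(\<lambda>(m, p). m + p) ` (M \<times> N) \<noteq> L"
        using sum_eq_L_iff[OF N_axis] N_directions by simp
      moreover have "(\<lambda>(m, p). m + p) ` (M \<times> N) \<subseteq> L"
        using N_subset M_subset vec.subspace_add[OF subspace_L] by auto
      ultimately show ?thesis using that by blast
    qed
    define K where "K = vec.span (insert (v + w) N)"
    note K = line_through_affine[OF N_axis w(1), folded K_def]
    have "v + u \<notin> K" if "u \<in> M" for u
    proof
      assume "v + u \<in> K"
      then have "(v + w) - (v + u) \<in> K"
        using K(1,5) by (intro vec.subspace_diff)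
      moreover have "w - u \<in> L"
        using w(1) that M_subset by (intro vec.subspace_diff[OF subspace_L]) auto
      ultimately have "w - u \<in> N"
        unfolding K(4)[symmetric] by simp
      then have "w \<in> (\<lambda>(m, p). m + p) ` (M \<times> N)"
        using that by (intro image_eqI[of _ _ "(u, w - u)"]) auto
      with w show False by simp
    qed
    then have "card (arc \<inter> {P \<in> plane_points. P \<subseteq> K}) = 0"
      using card_arc_Int[OF K(1-3)] K(4) N_directions by simp
    then show ?thesis
      using K by (auto simp: plane_lines_def)
  qed
  moreover have "\<exists>m \<in> plane_lines. card (arc \<inter> m) = 2"
  proof -
    have "axis - directions \<noteq> {}"
      using card_axis_minus_directions t_ge by (metis card.empty not_numeral_le_zero)
    then obtain P where P: "P \<in> axis" "P \<notin> directions" by blast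
    \<comment> \<open>Every line through a non-direction other than the axis is a 2-secant. Writing
      \<open>v + 0\<close> is the choice \<open>w = 0\<close> in
      \<open>line_through_affine\<close>.\<close>
    define K where "K = vec.span (insert (v + 0) P)"
    note K = line_through_affine[OF P(1) vec.subspace_0[OF subspace_L], folded K_def]
    have "card (arc \<inter> {P \<in> plane_points. P \<subseteq> K}) = 2"
      using card_arc_Int[OF K(1-3)] K(4) P by simp
    then show ?thesis
      using K by (auto simp: plane_lines_def)
  qed
  moreover have "\<exists>m \<in> plane_lines. card (arc \<inter> m) = t"
    using axis_line arc_Int_axis card_axis_minus_directions by (intro bexI[of _ axis]) simp_all
  ultimately show ?thesis
    by (auto simp: KM_arc_def arc_subset card_arc)
qed

text \<open>The bound on \<open>t\<close> separates the \<open>t\<close>-secants from the 2-secants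
  through non-directions, which miss \<open>N\<close>.\<close>

lemma nucleus_arc:
  assumes "2 < t"
  shows "nucleus t arc N"
proof -
  have "N \<in> m" if m: "m \<in> secants t arc" for m
  proof (cases "m = axis")
    case True
    then show ?thesis by (simp add: N_axis)
  next
    case False
    moreover have "m \<in> plane_lines"
      using m by (simp add: secants_def)
    ultimately obtain K where K: "m = {P \<in> plane_points. P \<subseteq> K}"
      "vec.subspace K" "vec.dim K = 2" "K \<noteq> L"
      using line_cases by metis
    have P: "K \<inter> L \<in> plane_points"
      using K plane_points_Int_L by blast
    have "card (arc \<inter> m) = t"
      using m by (simp add: secants_def)
    then have "K \<inter> L \<in> directions" "card (M \<inter> (K \<inter> L)) = t"
      using card_arc_Int[OF K(2-4)] K(1) assms by (auto split: if_splits)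
    then have "K \<inter> L = N"
      using card_M_other[OF P] assms P by (auto simp: in_directions_iff)
    then show ?thesis
      using K N_point by auto
  qed
  moreover have "P = N" if P: "P \<in> plane_points" "\<forall>m \<in> secants t arc. P \<in> m" for P
  proof -
    \<comment> \<open>As \<open>0 \<in> M\<close>, the span of \<open>v\<close> is an affine point,
      so joining it to \<open>N\<close> gives a \<open>t\<close>-secant. It meets the axis, another
      \<open>t\<close>-secant, only in \<open>N\<close>, which leaves no second common
      point.\<close>
    define K where "K = vec.span (insert (v + 0) N)"
    note K = line_through_affine[OF N_axis vec.subspace_0[OF subspace_L], folded K_def]
    have "{u \<in> M. v + u \<in> K} \<noteq> {}"
      using zero_M K(5) by auto
    then have "card (arc \<inter> {P \<in> plane_points. P \<subseteq> K}) = t"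
      unfolding card_arc_Int[OF K(1-3)] K(4) using N_directions card_M_N by (simp del: Collect_empty_eq)
    then have "{P \<in> plane_points. P \<subseteq> K} \<in> secants t arc"
      using K by (auto simp: secants_def plane_lines_def)
    moreover have "axis \<in> secants t arc"
      using axis_line arc_Int_axis card_axis_minus_directions by (simp add: secants_def)
    ultimately have "P \<subseteq> K" "P \<subseteq> L"
      using P by (auto simp: axis_def)
    then have "P \<subseteq> N" using K(4) by auto
    then show ?thesis
      using plane_point_nonzero[OF P(1)] plane_points_eqI[OF P(1) N_point] by blast
  qed
  ultimately have "P \<in> plane_points \<and> (\<forall>m \<in> secants t arc. P \<in> m) \<longleftrightarrow> P = N" for P
    using N_point by metis
  then show ?thesis
    by (simp add: nucleus_def)
qed

section \<open>Elations with the given axis\<close>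

text \<open>The linear form with kernel \<open>L\<close> that takes the value 1 at \<open>v\<close>.\<close>

definition coord :: "'a ^ 3 \<Rightarrow> 'a"
  where "coord x = (THE k. \<exists>w\<in>L. x = k *s v + w)"

text \<open>For \<open>w\<close> in \<open>L\<close> this is a transvection: it fixes every vector
  of \<open>L\<close> and sends \<open>v + u\<close> to \<open>v + (u + w)\<close> for
  \<open>u\<close> in \<open>L\<close>.\<close>

definition translate :: "'a ^ 3 \<Rightarrow> 'a ^ 3 \<Rightarrow> 'a ^ 3"
  where "translate w x = x + coord x *s w"

lemma coord_eq: "w \<in> L \<Longrightarrow> coord (k *s v + w) = k"
  unfolding coord_def using decompose_unique by (intro the_equality) blast+

lemma coord_L: "w \<in> L \<Longrightarrow> coord w = 0"
  using coord_eq[of w 0] by simp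

lemma coord_add: "coord (x + y) = coord x + coord y"
proof -
  obtain k w where w: "w \<in> L" "x = k *s v + w" by (rule decompose)
  obtain k' w' where w': "w' \<in> L" "y = k' *s v + w'" by (rule decompose)
  have "x + y = (k + k') *s v + (w + w')"
    using w w' by (simp add: vec.scale_left_distrib algebra_simps)
  then show ?thesis
    using w w' coord_eq vec.subspace_add[OF subspace_L] by metis
qed

lemma coord_scale: "coord (c *s x) = c * coord x"
proof -
  obtain k w where w: "w \<in> L" "x = k *s v + w" by (rule decompose)
  have "c *s x = (c * k) *s v + c *s w"
    using w by (simp add: vec.scale_right_distrib)
  then show ?thesis
    using w coord_eq vec.subspace_scale[OF subspace_L] by metis
qed

lemma linear_translate: "Vector_Spaces.linear (*s) (*s) (translate w)"
  by unfold_locales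
     (simp_all add: translate_def coord_add coord_scale vec.scale_left_distrib
        vec.scale_right_distrib algebra_simps)

text \<open>As \<open>coord\<close> vanishes at \<open>w\<close>, the inner map preserves
  \<open>coord x\<close>, so the outer one subtracts what was added.\<close>

lemma translate_inverse: "w \<in> L \<Longrightarrow> translate (- w) (translate w x) = x"
  by (simp add: translate_def coord_add coord_scale coord_L)

lemma image_translate_inverse: "w \<in> L \<Longrightarrow> translate (- w) ` translate w ` X = X"
  by (simp add: image_image translate_inverse)

lemma inj_translate: "w \<in> L \<Longrightarrow> inj (translate w)"
  using translate_inverse by (metis injI)

lemma subspace_translate: "vec.subspace X \<Longrightarrow> vec.subspace (translate w ` X)"
  by (rule vec.linear_subspace_image[OF linear_translate])

lemma dim_translate: "w \<in> L \<Longrightarrow> vec.dim (translate w ` X) = vec.dim X"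
  using vec.dim_image_eq[OF linear_translate, of w X] inj_translate inj_on_subset by blast

lemma translate_plane_points: "w \<in> L \<Longrightarrow> P \<in> plane_points \<Longrightarrow> translate w ` P \<in> plane_points"
  by (simp add: plane_points_def subspace_translate dim_translate)

lemma minus_L: "w \<in> L \<Longrightarrow> - w \<in> L"
  using vec.subspace_neg[OF subspace_L] by simp

lemma translate_line:
  assumes w: "w \<in> L"
  shows "(`) (translate w) ` {P \<in> plane_points. P \<subseteq> K} = {P \<in> plane_points. P \<subseteq> translate w ` K}"
proof (intro equalityI subsetI)
  fix P assume P: "P \<in> {P \<in> plane_points. P \<subseteq> translate w ` K}"
  then have "translate (- w) ` P \<subseteq> K"
    using image_translate_inverse[OF w, of K] image_mono by fastforce
  then show "P \<in> (`) (translate w) ` {P \<in> plane_points. P \<subseteq> K}"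
    using P translate_plane_points[OF minus_L[OF w]] image_translate_inverse[OF minus_L[OF w], of P]
    by (intro image_eqI[of _ _ "translate (- w) ` P"]) auto
qed (use translate_plane_points[OF w] in auto)

lemma translate_plane_lines:
  assumes w: "w \<in> L" and m: "m \<in> plane_lines"
  shows "(`) (translate w) ` m \<in> plane_lines"
proof -
  obtain K where K: "m = {P \<in> plane_points. P \<subseteq> K}" "vec.subspace K" "vec.dim K = 2"
    using m by (auto simp: plane_lines_def)
  show ?thesis
    unfolding plane_lines_def K(1) translate_line[OF w]
    using subspace_translate[OF K(2)] K(3) dim_translate[OF w, of K]
    by (intro CollectI exI[of _ "translate w ` K"]) simp
qed

lemma collineation_translate:
  assumes w: "w \<in> L"
  shows "collineation ((`) (translate w))"
proof -
  \<comment> \<open>Replacing \<open>- (- w)\<close> by \<open>w\<close> gives both inverse laws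
    from one lemma.\<close>
  note inv = image_translate_inverse[OF w] image_translate_inverse[OF minus_L[OF w], simplified]
  have "bij_betw ((`) (translate w)) plane_points plane_points"
    by (rule bij_betw_byWitness[of _ "(`) (translate (- w))"])
       (auto simp: inv translate_plane_points w minus_L)
  moreover have "bij_betw ((`) ((`) (translate w))) plane_lines plane_lines"
    by (rule bij_betw_byWitness[of _ "(`) ((`) (translate (- w)))"])
       (auto simp: inv image_image[of "(`) _"] translate_plane_lines w minus_L)
  ultimately show ?thesis by (simp add: collineation_def)
qed

lemma translate_axis: "P \<in> axis \<Longrightarrow> translate w ` P = P"
proof -
  assume "P \<in> axis"
  then have "translate w x = x" if "x \<in> P" for x
    using that by (auto simp: translate_def axis_def coord_L)
  then show ?thesis by simp
qed

text \<open>Each vector moves by a multiple of \<open>w\<close>, so every subspace containing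
  \<open>w\<close> is preserved. The centre is therefore the point spanned by
  \<open>w\<close>.\<close>

lemma elation_translate:
  assumes w: "w \<in> L"
  shows "elation axis ((`) (translate w))"
proof -
  obtain Z where Z: "Z \<in> axis" "w \<in> Z"
  \<comment> \<open>For \<open>w = 0\<close> the map is the identity and any point of the axis can
    be its centre; \<open>N\<close> is one at hand.\<close>
  proof (cases "w = 0")
    case True
    then show ?thesis
      using that[OF N_axis] N_point by (auto simp: plane_points_def vec.subspace_0)
  next
    case False
    then show ?thesis
      using that[of "vec.span {w}"] w span_in_plane_points[of w] span_singleton_subset_iff[OF subspace_L]
      by (auto simp: axis_def vec.span_base)
  qed
  have "(`) (translate w) ` m = m" if m: "m \<in> plane_lines" "Z \<in> m" for m
  proof -
    obtain K where K: "m = {P \<in> plane_points. P \<subseteq> K}" "vec.subspace K"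
      using m by (auto simp: plane_lines_def)
    with m Z have "w \<in> K" by auto
    then have sub: "translate w x \<in> K" "translate (- w) x \<in> K" if "x \<in> K" for x
      using that K by (auto simp: translate_def intro!: vec.subspace_add vec.subspace_scale
        vec.subspace_neg vec.subspace_diff)
    have "translate w ` K = K"
    proof
      show "K \<subseteq> translate w ` K"
      proof
        fix x assume "x \<in> K"
        then show "x \<in> translate w ` K"
          using sub translate_inverse[OF minus_L[OF w], of x]
          by (intro image_eqI[of _ _ "translate (- w) x"]) auto
      qed
    qed (use sub in auto)
    then show ?thesis
      unfolding K(1) translate_line[OF w] by simp
  qed
  then have "\<exists>Z\<in>axis. \<forall>m\<in>plane_lines. Z \<in> m \<longrightarrow> (`) (translate w) ` m = m"
    using Z(1) by (intro bexI[of _ Z]) auto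
  then show ?thesis
    using collineation_translate[OF w] translate_axis by (simp add: elation_def)
qed

lemma translate_affine_point:
  assumes "u \<in> L"
  shows "translate w ` vec.span {v + u} = vec.span {v + (u + w)}"
proof -
  have "coord (v + u) = 1"
    using coord_eq[OF assms, of 1] by simp
  then show ?thesis
    using vec.linear_span_image[OF linear_translate, of w "{v + u}"]
    by (simp add: translate_def add.assoc)
qed

text \<open>The parameter \<open>u\<close> becomes \<open>u + w\<close>, which permutes
  \<open>M\<close> because \<open>w\<close> itself belongs to the group \<open>M\<close>.\<close>

lemma translate_affine_points:
  assumes w: "w \<in> M"
  shows "(`) (translate w) ` affine_points = affine_points"
proof -
  have "(`) (translate w) ` affine_points = (\<lambda>u. vec.span {v + (u + w)}) ` M"
    unfolding affine_points_def image_image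
    using translate_affine_point M_subset by (intro image_cong) auto
  also have "\<dots> = (\<lambda>u. vec.span {v + u}) ` (\<lambda>u. u + w) ` M"
    by (simp add: image_image)
  also have "(\<lambda>u. u + w) ` M = M"
  proof
    show "M \<subseteq> (\<lambda>u. u + w) ` M"
      using diff_M w by (auto intro!: image_eqI[of _ _ "_ - w"])
  qed (use w plus_M in auto)
  finally show ?thesis by (simp add: affine_points_def)
qed

lemma translation_set_arc: "translation_set axis arc"
proof -
  have "\<exists>\<phi>. elation axis \<phi> \<and> \<phi> ` arc = arc \<and> \<phi> P = Q"
    if PQ: "P \<in> arc - axis" "Q \<in> arc - axis" for P Q
  proof -
    obtain u u' where u: "u \<in> M" "u' \<in> M" "P = vec.span {v + u}" "Q = vec.span {v + u'}"
      using PQ by (auto simp: arc_def affine_points_def)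
    \<comment> \<open>This difference lies in the group \<open>M\<close> and carries
      \<open>v + u\<close> to \<open>v + u'\<close>.\<close>
    define w where "w = u' - u"
    have w: "w \<in> M" using u diff_M by (simp add: w_def)
    have "(`) (translate w) ` (axis - directions) = axis - directions"
      using translate_axis by simp
    then have "(`) (translate w) ` arc = arc"
      using translate_affine_points[OF w] by (simp add: arc_def image_Un)
    moreover have "translate w ` P = Q"
      using u M_subset translate_affine_point[of u w] by (auto simp: w_def)
    ultimately show ?thesis
      using elation_translate[of w] w M_subset by blast
  qed
  then show ?thesis
    using arc_subset axis_line by (auto simp: translation_set_def)
qed

end

section \<open>From field reduction to the additive group\<close>

text \<open>The nucleus is claimed for \<open>2 \<le> i\<close> because for \<open>i = 1\<close> the
  arc has type 2 and is a hyperoval, whose secants are not concurrent.\<close>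

theorem theorem2p1:
  fixes h i :: nat
    and l :: "('a::{field,finite} ^ 3) set set"
    and H \<mu> \<rho> \<pi> N :: "('a ^ 3) set"
    and C :: "('a ^ 3) set set"
  assumes "h \<ge> 1" and "1 \<le> i" and "i \<le> h"
    and "CARD('a) = 2 ^ h"
    and "l \<in> plane_lines"
    and "proj_subspace H" and "proj_dim H = 2 * int h - 1" and "B_set H = l"
    and "\<mu> \<subseteq> H" and "proj_subspace \<mu>" and "proj_dim \<mu> = int h - 1"
    and "C = B_set \<mu>" and "club i h \<mu> N" and "N \<in> l"
    and "\<rho> \<in> desarguesian_spread" and "B_set \<rho> = {N}"
    and "proj_subspace \<pi>" and "proj_dim \<pi> = int h" and "\<pi> \<inter> H = \<mu>"
  shows "translation_KM_arc (2 ^ i) l ((B_set \<pi> - C) \<union> (l - C)) \<and>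
         (2 \<le> i \<longrightarrow> nucleus (2 ^ i) ((B_set \<pi> - C) \<union> (l - C)) N)"
proof -
  interpret bit: vector_space "bit_scale :: bit \<Rightarrow> 'a ^ 3 \<Rightarrow> 'a ^ 3"
    by (rule vector_space_bit_scale[OF assms(4)])
  have bit_UNIV: "(UNIV :: bit set) = {0, 1}"
    by (auto intro: bit.exhaust)
  \<comment> \<open>The vector space dimension is one more than \<open>proj_dim\<close> and is
    unaffected by adding 0.\<close>
  have card_bit: "card (insert 0 U) = 2 ^ d"
    if "bit.subspace (insert 0 U)" "proj_dim U = int d - 1" for U :: "('a ^ 3) set" and d
  proof -
    have "bit.dim (insert 0 U) = d"
      using that(2) bit.dim_span[of U] bit.dim_span[of "insert 0 U"] bit.span_insert_0[of U]
      by (simp add: proj_dim_def)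
    then show ?thesis
      using bit.card_subspace[OF _ that(1)] by (simp add: bit_UNIV numeral_2_eq_2)
  qed
  obtain L where L: "vec.subspace L" "vec.dim L = 2" "l = {P \<in> plane_points. P \<subseteq> L}"
    using assms(5) by (auto simp: plane_lines_def)
  have card_L: "card L = CARD('a) ^ 2"
    using vec.card_subspace[of L] L by simp
  have H0: "0 \<notin> H" and H: "bit.subspace (insert 0 H)"
    using assms(6) by (auto simp: proj_subspace_def)
  \<comment> \<open>A nonzero vector of \<open>H\<close> spans a point of \<open>l\<close>, which
    gives one inclusion; both sets have \<open>2 ^ (2 * h)\<close> elements.\<close>
  have "insert 0 H = L"
  proof (rule card_subset_eq)
    show "insert 0 H \<subseteq> L"
    proof
      fix x assume x: "x \<in> insert 0 H"
      show "x \<in> L"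
      proof (cases "x = 0")
        case True
        then show ?thesis using vec.subspace_0[OF L(1)] by simp
      next
        case False
        then have "vec.span {x} \<in> B_set H"
          using x span_in_plane_points[of x]
          by (auto simp: B_set_def spread_element_def intro: vec.span_base)
        then show ?thesis
          using assms(8) L(3) vec.span_base[of x "{x}"] by auto
      qed
    qed
    have "card (insert 0 H) = 2 ^ (2 * h)"
      using H assms(7) by (intro card_bit) auto
    then show "card (insert 0 H) = card L"
      by (simp add: card_L assms(4) power_mult mult.commute)
  qed simp
  define M where "M = insert 0 \<mu>"
  have \<mu>0: "0 \<notin> \<mu>" and M: "bit.subspace M"
    using assms(10) by (auto simp: proj_subspace_def M_def)
  have \<mu>: "\<mu> = M - {0}"
    using \<mu>0 by (simp add: M_def)
  have M_L: "M \<subseteq> L"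
    using assms(9) \<open>insert 0 H = L\<close> by (auto simp: M_def)
  have card_M: "card M = 2 ^ h"
    using M assms(11) unfolding M_def by (rule card_bit)
  have \<pi>0: "0 \<notin> \<pi>" and \<pi>: "bit.subspace (insert 0 \<pi>)"
    using assms(17) by (auto simp: proj_subspace_def)
  have card_\<pi>: "card (insert 0 \<pi>) = 2 ^ Suc h"
    using \<pi> assms(18) by (intro card_bit) auto
  have \<pi>_L: "insert 0 \<pi> \<inter> L = M"
    using assms(19) \<open>insert 0 H = L\<close> \<pi>0 H0 by (auto simp: M_def)
  have "\<not> insert 0 \<pi> \<subseteq> L"
  proof
    assume "insert 0 \<pi> \<subseteq> L"
    then have "insert 0 \<pi> = M" using \<pi>_L by auto
    then show False using card_\<pi> card_M by simp
  qed
  then obtain v where v: "v \<in> insert 0 \<pi>" "v \<notin> L" by blast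
  have vM: "v + u \<notin> L" if "u \<in> M" for u
    using v that M_L vec.subspace_diff[OF L(1), of "v + u" u] by auto
  \<comment> \<open>\<open>M\<close> has index 2 in \<open>insert 0 \<pi>\<close>, and any
    \<open>v\<close> of the latter outside \<open>L\<close> represents the other coset.\<close>
  have \<pi>_eq: "insert 0 \<pi> = M \<union> (\<lambda>u. v + u) ` M"
  proof (rule card_subset_eq[symmetric])
    show "M \<union> (\<lambda>u. v + u) ` M \<subseteq> insert 0 \<pi>"
      using \<pi>_L v bit.subspace_add[OF \<pi>] by blast
    have "card (M \<union> (\<lambda>u. v + u) ` M) = card M + card ((\<lambda>u. v + u) ` M)"
      using vM M_L by (intro card_Un_disjoint) auto
    then show "card (M \<union> (\<lambda>u. v + u) ` M) = card (insert 0 \<pi>)"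
      by (simp add: card_image card_M card_\<pi>)
  qed simp
  \<comment> \<open>A point is also a subspace over \<open>bit\<close>, so its weight is the
    dimension over \<open>bit\<close> of \<open>M \<inter> P\<close>.\<close>
  have card_weight: "card (M \<inter> P) = 2 ^ d" if P: "P \<in> plane_points" "weight \<mu> P = int d" for P d
  proof -
    have "0 \<in> P" using P by (simp add: plane_points_def vec.subspace_0)
    then have eq: "M \<inter> P = insert 0 (\<mu> \<inter> spread_element P)"
      by (auto simp: M_def spread_element_def)
    have "bit.subspace P"
      unfolding bit.subspace_def using P
      by (auto simp: plane_points_def bit_scale_def vec.subspace_0 intro: vec.subspace_add
        vec.subspace_scale)
    then have "bit.subspace (M \<inter> P)"
      using M by (simp add: bit.subspace_inter)
    then show ?thesis
      unfolding eq using P by (intro card_bit) (simp_all add: weight_def)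
  qed
  have N: "N \<in> plane_points" "N \<subseteq> L"
    using assms(14) L by auto
  interpret affine_club L M N v "2 ^ i"
  proof
    show "vec.subspace L" "vec.dim L = 2" "v \<notin> L" "M \<subseteq> L" "0 \<in> M"
      "N \<in> plane_points" "N \<subseteq> L"
      using L v M_L N by (auto simp: M_def)
    show "x - y \<in> M" if "x \<in> M" "y \<in> M" for x y
      using that M by (rule bit.subspace_diff[rotated])
    show "card M = CARD('a)" by (simp add: card_M assms(4))
    show "card (M \<inter> N) = 2 ^ i"
      using N assms(13) by (intro card_weight) (auto simp: club_def)
    show "2 \<le> (2 :: nat) ^ i"
      using assms(2) by (cases i) auto
    show "card (M \<inter> P) = 2" if "P \<in> plane_points" "P \<noteq> N" "M \<inter> P \<noteq> {0}" for P
    proof -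
      have "0 \<in> M \<inter> P"
        using that by (simp add: plane_points_def vec.subspace_0 M_def)
      then have "P \<in> B_set \<mu>"
        using that unfolding \<mu> by (auto simp: B_set_def spread_element_def)
      then have "weight \<mu> P = int 1"
        using that assms(13) by (auto simp: club_def)
      then show ?thesis
        using card_weight[OF that(1)] by fastforce
    qed
  qed
  have l: "l = axis" by (simp add: L(3) axis_def)
  have C: "C = directions" by (simp add: assms(12) directions_def \<mu>)
  have "B_set \<pi> - C = affine_points"
  proof (intro equalityI subsetI)
    fix P assume P: "P \<in> B_set \<pi> - C"
    then obtain x where x: "x \<in> P" "x \<noteq> 0" "x \<in> \<pi>" "P \<in> plane_points"
      by (auto simp: B_set_def spread_element_def)
    \<comment> \<open>A nonzero vector of \<open>M\<close> in \<open>P\<close> would make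
      \<open>P\<close> a direction, so \<open>x\<close> lies in the coset of
      \<open>v\<close>.\<close>
    have "x \<notin> M"
      using x P C by (auto simp: in_directions_iff)
    then obtain u where "u \<in> M" "x = v + u"
      using x \<pi>_eq by auto
    then show "P \<in> affine_points"
      using plane_point_eq_span[of P x] x by (auto simp: affine_points_def)
  next
    fix P assume P: "P \<in> affine_points"
    then obtain u where u: "u \<in> M" "P = vec.span {v + u}"
      by (auto simp: affine_points_def)
    have "v + u \<in> \<pi>"
      using u \<pi>_eq affine_nonzero M_L by blast
    moreover have "v + u \<in> spread_element P"
      using u affine_nonzero M_L by (auto simp: spread_element_def vec.span_base)
    ultimately have "P \<in> B_set \<pi>"
      using P affine_points_subset by (auto simp: B_set_def)
    then show "P \<in> B_set \<pi> - C"
      using P C affine_points_axis directions_subset_axis by blast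
  qed
  then have arc: "(B_set \<pi> - C) \<union> (l - C) = arc"
    by (simp add: arc_def l C)
  have "2 < (2 :: nat) ^ i" if "2 \<le> i"
    using that power_strict_increasing[of 1 i "2::nat"] by simp
  then show ?thesis
    unfolding arc using KM_arc_arc translation_set_arc nucleus_arc
    by (simp add: translation_KM_arc_def l)
qed

end
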